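(* Let $M>1$ and $\mathcal R=[1/M,M]$. For any $\epsilon\in(0,1]$, given a second-order conic approximation $C_q$ with $q$ variables and second-order conic constraints such that $$K_{\exp}(-\epsilon)\subseteq C_q\subseteq K_{\exp}(\epsilon),$$ we have $q=\Omega\left(1+\dfrac{\log\log(M)}{\log(1/\epsilon)}\right)$.
   Context: For $\alpha\in\mathbb R$, $K_{\exp}(\alpha)=\{\boldsymbol x=(x_1,x_2,x_3)\in\mathcal R^2\times\mathbb R:\ \log(x_1/x_2)\ge x_3/x_2-\alpha\}$. A second-order conic approximation with $q$ variables and second-order conic constraints is a set described, in $(x_1,x_2,x_3)$ and possibly additional real variables, by constraints of the form $(a_1^\top w+b_1,\,a_2^\top w+b_2,\,a_3^\top w+b_3)\in\mathcal L_3$, where $w$ is the vector of all variables and $\mathcal L_3=\{y\in\mathbb R^3:y_3\ge\sqrt{y_1^2+y_2^2}\}$, the number of variables and constraints being $q$; the inclusions are understood for its projection onto $(x_1,x_2,x_3)$. $\Omega(\cdot)$ is the usual order notation, in terms of $M$ and $\epsilon$.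
   Formalization: One Ω-constant for all ε in (0,1) is impossible, since log(1/ε)→0 as ε→1 with M fixed; so the constant is uniform over M>1 and ε≤ε₀, for each ε₀<1, and may depend on ε₀. At ε=1, where the quotient is undefined, only q=Ω(1) is asserted. *)

theory Defs
  imports Complex_Main
begin

definition lorentz3 :: "(real \<times> real \<times> real) set" where
  "lorentz3 = {(y1, y2, y3). y3 \<ge> sqrt (y1\<^sup>2 + y2\<^sup>2)}"

definition Kexp :: "real \<Rightarrow> real \<Rightarrow> (real \<times> real \<times> real) set" where
  "Kexp M \<alpha> = {(x1, x2, x3). x1 \<in> {1 / M..M} \<and> x2 \<in> {1 / M..M} \<and>
                              ln (x1 / x2) \<ge> x3 / x2 - \<alpha>}"

definition affine_form :: "nat \<Rightarrow> (nat \<Rightarrow> real) \<Rightarrow> real \<Rightarrow> (nat \<Rightarrow> real) \<Rightarrow> real" where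
  "affine_form n a b w = (\<Sum>i<n. a i * w i) + b"

(* The j-th of the m constraints has coefficient vectors a j 1, a j 2, a j 3 and constant
   terms b j 1, b j 2, b j 3.  Of the n variables w 0, ..., w (n - 1), the first three are
   the coordinates of the point; the others are additional variables and are projected out. *)
definition conic_projection ::
    "nat \<Rightarrow> nat \<Rightarrow> (nat \<Rightarrow> nat \<Rightarrow> nat \<Rightarrow> real) \<Rightarrow> (nat \<Rightarrow> nat \<Rightarrow> real) \<Rightarrow> (real \<times> real \<times> real) set" where
  "conic_projection n m a b =
     {(x1, x2, x3). \<exists>w. w 0 = x1 \<and> w 1 = x2 \<and> w 2 = x3 \<and>
        (\<forall>j<m. (affine_form n (a j 1) (b j 1) w,
                affine_form n (a j 2) (b j 2) w,
                affine_form n (a j 3) (b j 3) w) \<in> lorentz3)}"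

(* q is the total of the variables (including the three coordinates) and the constraints. *)
definition second_order_conic_approx :: "nat \<Rightarrow> (real \<times> real \<times> real) set \<Rightarrow> bool" where
  "second_order_conic_approx q C \<longleftrightarrow>
     (\<exists>n m a b. 3 \<le> n \<and> n + m = q \<and> C = conic_projection n m a b)"

end

theory Submission
  imports
    Defs
    "HOL-Analysis.Analysis"
    "HOL-Computational_Algebra.Fundamental_Theorem_Algebra"
    "HOL-Library.Function_Algebras"
begin

text \<open>
  Fix \<open>x\<^sub>2 = 1\<close> and \<open>x\<^sub>1 = exp t\<close>: the set \<open>C\<close> then contains a point with third coordinate
  \<open>t - \<epsilon>\<close> and none with third coordinate above \<open>t + \<epsilon>\<close>. With slack variables, membership in \<open>C\<close>
  becomes the vanishing of a nonnegative polynomial \<open>E\<close> of degree 4 in at most \<open>2 q\<close> variables.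
  For any finite set of parameters \<open>t\<close>, minimising \<open>A E + \<mu> \<Sum> u\<^sub>i\<^sup>6 - x\<^sub>3\<close> with \<open>\<mu>\<close> small and \<open>A\<close>
  large yields a solution with \<open>\<bar>x\<^sub>3 - t\<bar> \<le> 2\<close> of a system \<open>u\<^sub>i\<^sup>5 = g\<^sub>i\<close> that does not depend on
  \<open>t\<close>, where \<open>g\<^sub>i\<close> has degree at most 4. Modulo this system every polynomial reduces to exponents
  at most 4 in all variables but \<open>x\<^sub>1\<close>, so counting dimensions gives a nonzero polynomial \<open>P\<close>, of
  degree exponential in \<open>q\<close>, such that \<open>P(x\<^sub>1, x\<^sub>3) = 0\<close> at all these solutions. Since \<open>exp t\<close>
  grows faster than powers of \<open>x\<^sub>3 \<approx> t\<close>, such a relation cannot hold at too many values of \<open>t\<close>,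
  which bounds \<open>ln M\<close> by a fixed power of \<open>deg P\<close>.
\<close>

section \<open>Polynomial relations between a number and its approximate logarithm\<close>

lemma poly_map_poly_of_real:
  "poly (map_poly of_real p) (of_real x :: 'a::real_field) = of_real (poly p x)"
  by (induction p) (auto simp: map_poly_pCons)

lemma norm_poly_le_away_from_roots:
  fixes p :: "complex poly"
  assumes "r > 0" and away: "\<And>z. poly p z = 0 \<Longrightarrow> r \<le> dist x z"
  shows "norm (poly p y) \<le> exp (degree p * dist y x / r) * norm (poly p x)"
proof -
  obtain root where root: "smult (lead_coeff p) (\<Prod>i<degree p. [:-root i, 1:]) = p"
    by (rule complex_poly_decompose')
  have norm_poly: "norm (poly p u) = norm (lead_coeff p) * (\<Prod>i<degree p. dist u (root i))" for u
    by (subst root [symmetric]) (simp add: poly_prod norm_mult prod_norm dist_norm)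
  have factor: "dist y (root i) \<le> exp (dist y x / r) * dist x (root i)" if "i < degree p" for i
  proof -
    have "poly p (root i) = 0"
      by (subst root [symmetric]) (use that in \<open>auto simp: poly_prod intro!: bexI [of _ i]\<close>)
    then have "dist y x / r * r \<le> dist y x / r * dist x (root i)"
      using \<open>r > 0\<close> by (intro mult_left_mono away) auto
    then have "dist y (root i) \<le> (1 + dist y x / r) * dist x (root i)"
      using \<open>r > 0\<close> dist_triangle [of y "root i" x] by (simp add: algebra_simps)
    also have "\<dots> \<le> exp (dist y x / r) * dist x (root i)"
      by (intro mult_right_mono exp_ge_add_one_self) auto
    finally show ?thesis .
  qed
  have "norm (poly p y) \<le>
      norm (lead_coeff p) * (\<Prod>i<degree p. exp (dist y x / r) * dist x (root i))"
    unfolding norm_poly by (intro mult_left_mono prod_mono) (auto simp: factor)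
  also have "\<dots> = exp (dist y x / r) ^ degree p * norm (poly p x)"
    by (simp add: norm_poly prod.distrib)
  also have "exp (dist y x / r) ^ degree p = exp (degree p * dist y x / r)"
    by (simp add: exp_of_nat_mult [symmetric])
  finally show ?thesis .
qed

definition complex_roots :: "real poly \<Rightarrow> complex set" where
  "complex_roots p = {z. poly (map_poly of_real p) z = 0}"

lemma of_real_in_complex_roots_iff: "of_real x \<in> complex_roots p \<longleftrightarrow> poly p x = 0"
  by (simp add: complex_roots_def poly_map_poly_of_real)

lemma
  assumes "p \<noteq> 0"
  shows finite_complex_roots: "finite (complex_roots p)"
    and card_complex_roots_le: "card (complex_roots p) \<le> degree p"
proof -
  have "map_poly complex_of_real p \<noteq> 0" and "degree (map_poly complex_of_real p) = degree p"
    using assms by (simp_all add: map_poly_eq_0_iff degree_map_poly)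
  then show "finite (complex_roots p)" and "card (complex_roots p) \<le> degree p"
    unfolding complex_roots_def
    using poly_roots_finite card_poly_roots_bound by metis+
qed

lemma abs_poly_le_away_from_complex_roots:
  fixes x y L r :: real
  assumes "r > 0" "L > 0" "L * degree p \<le> r"
    and "\<And>z. z \<in> complex_roots p \<Longrightarrow> r \<le> dist (complex_of_real x) z"
  shows "\<bar>poly p y\<bar> \<le> exp (\<bar>y - x\<bar> / L) * \<bar>poly p x\<bar>"
proof -
  have "\<bar>poly p y\<bar> \<le> exp (degree p * \<bar>y - x\<bar> / r) * \<bar>poly p x\<bar>"
    using norm_poly_le_away_from_roots
        [of r "map_poly of_real p" "complex_of_real x" "complex_of_real y"] assms
    by (simp add: complex_roots_def poly_map_poly_of_real degree_map_poly dist_of_real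
        dist_real_def)
  also have "degree p * \<bar>y - x\<bar> / r \<le> \<bar>y - x\<bar> / L"
    using mult_right_mono [OF assms(3), of "\<bar>y - x\<bar>"] assms(1,2) by (simp add: field_simps)
  finally show ?thesis by (simp add: mult_right_mono)
qed

lemma card_near_finite_set_le:
  fixes f :: "'a \<Rightarrow> 'b::metric_space"
  assumes "finite R" and sep: "pairwise (\<lambda>s t. 2 * r \<le> dist (f s) (f t)) T"
  shows "card {t \<in> T. \<exists>z\<in>R. dist (f t) z < r} \<le> card R"
proof (rule card_le_if_inj_on_rel [where r = "\<lambda>t z. dist (f t) z < r", OF \<open>finite R\<close>])
  fix s t z
  assume "s \<in> {t \<in> T. \<exists>z\<in>R. dist (f t) z < r}" "t \<in> {t \<in> T. \<exists>z\<in>R. dist (f t) z < r}"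
  then have "s \<in> T" "t \<in> T" by simp_all
  assume "dist (f s) z < r" "dist (f t) z < r"
  then have "dist (f s) (f t) < 2 * r" using dist_triangle2 [of "f s" "f t" z] by linarith
  then show "s = t" using sep \<open>s \<in> T\<close> \<open>t \<in> T\<close> by (force simp: pairwise_def)
qed auto

definition comparable :: "real \<Rightarrow> 'a::real_normed_vector \<Rightarrow> 'a \<Rightarrow> bool" where
  "comparable c x y \<longleftrightarrow> norm x \<le> c * norm y \<and> norm y \<le> c * norm x"

lemma comparable_sym: "comparable c x y \<Longrightarrow> comparable c y x"
  by (simp add: comparable_def)

lemma comparable_mono:
  assumes "comparable c x y" "c \<le> d"
  shows "comparable d x y"
  using assms unfolding comparable_def by (meson mult_right_mono norm_ge_zero order_trans)

lemma sum_eq_0_two_comparable: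
  fixes g :: "'a \<Rightarrow> 'b::real_normed_vector"
  assumes "finite A" "A \<noteq> {}" "sum g A = 0" and nonzero: "\<And>a. a \<in> A \<Longrightarrow> g a \<noteq> 0"
  obtains a b where "a \<in> A" "b \<in> A" "a \<noteq> b" "comparable (card A) (g a) (g b)"
proof -
  have ex_largest: "\<exists>a\<in>B. \<forall>b\<in>B. norm (g b) \<le> norm (g a)" if fin: "finite B" "B \<noteq> {}" for B
  proof -
    obtain a where "a \<in> B" "Max ((\<lambda>b. norm (g b)) ` B) = norm (g a)"
      by (rule obtains_MAX [OF fin])
    moreover have "norm (g b) \<le> Max ((\<lambda>b. norm (g b)) ` B)" if "b \<in> B" for b
      using fin(1) that by (intro Max_ge) auto
    ultimately show ?thesis by auto
  qed
  obtain a where a: "a \<in> A" and a_max: "\<And>b. b \<in> A \<Longrightarrow> norm (g b) \<le> norm (g a)"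
    using ex_largest [OF assms(1,2)] by auto
  have g_a: "g a = - sum g (A - {a})"
    using assms(1,3) a by (simp add: sum.remove [of A a] eq_neg_iff_add_eq_0)
  then have "A - {a} \<noteq> {}" using nonzero [OF a] by fastforce
  then obtain b where b: "b \<in> A - {a}" and b_max: "\<And>c. c \<in> A - {a} \<Longrightarrow> norm (g c) \<le> norm (g b)"
    using ex_largest [of "A - {a}"] assms(1) by auto
  have "norm (g a) \<le> card (A - {a}) * norm (g b)"
    unfolding g_a norm_minus_cancel by (intro sum_norm_bound b_max)
  also have "\<dots> \<le> card A * norm (g b)"
    using assms(1) by (intro mult_right_mono of_nat_mono card_mono) auto
  finally have "norm (g a) \<le> card A * norm (g b)" .
  moreover have "norm (g b) \<le> card A * norm (g a)"
  proof -
    have "1 \<le> card A" using assms(1,2) by (simp add: Suc_leI card_gt_0_iff)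
    then have "1 * norm (g a) \<le> card A * norm (g a)" by (intro mult_right_mono) auto
    then show ?thesis using a_max [of b] b by simp
  qed
  ultimately have "comparable (card A) (g a) (g b)" by (simp add: comparable_def)
  then show ?thesis using that a b by blast
qed

text \<open>Bivariate polynomials are nested with \<open>x\<close> as the outer variable: \<open>poly (poly p [:x:]) y\<close> is the
  sum of the terms \<open>poly (coeff p i) y * x ^ i\<close>.\<close>

lemma poly_poly_eq_0_two_comparable:
  fixes p :: "'a::real_normed_field poly poly"
  assumes "p \<noteq> 0" "degree p \<le> S" "x \<noteq> 0" and zero: "poly (poly p [:x:]) y = 0"
    and nonzero: "\<And>i. coeff p i \<noteq> 0 \<Longrightarrow> poly (coeff p i) y \<noteq> 0"
  obtains i j where "i < j" "j \<le> S" "coeff p i \<noteq> 0" "coeff p j \<noteq> 0"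
    "comparable (real S + 1) (poly (coeff p i) y * x ^ i) (poly (coeff p j) y * x ^ j)"
proof -
  define A where "A = {i. i \<le> degree p \<and> coeff p i \<noteq> 0}"
  define g where "g i = poly (coeff p i) y * x ^ i" for i
  have "A \<subseteq> {..S}" using \<open>degree p \<le> S\<close> by (auto simp: A_def)
  then have "finite A" and "card A \<le> S + 1"
    using card_mono [of "{..S}" A] by (auto intro: finite_subset)
  have "degree p \<in> A" using \<open>p \<noteq> 0\<close> by (simp add: A_def)
  have "sum g A = sum g {..degree p}"
    by (intro sum.mono_neutral_left) (auto simp: A_def g_def)
  also have "\<dots> = 0"
    using zero by (simp add: g_def poly_altdef [of p] poly_sum poly_power)
  finally have "sum g A = 0" .
  moreover have "g i \<noteq> 0" if "i \<in> A" for i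
    using that nonzero \<open>x \<noteq> 0\<close> by (simp add: g_def A_def)
  ultimately obtain i j where ij: "i \<in> A" "j \<in> A" "i \<noteq> j" "comparable (card A) (g i) (g j)"
    using sum_eq_0_two_comparable [of A g] \<open>finite A\<close> \<open>degree p \<in> A\<close> by blast
  have "comparable (real S + 1) (g i) (g j)"
    using ij(4) by (rule comparable_mono) (use \<open>card A \<le> S + 1\<close> in simp)
  then show ?thesis
    using that [of i j] that [of j i] ij \<open>A \<subseteq> {..S}\<close>
    by (cases "i < j") (auto simp: A_def g_def dest: comparable_sym)
qed

lemma abs_poly_times_exp_le:
  fixes p :: "real poly" and y y' t t' :: real
  assumes "degree p \<le> S"
    and "\<And>z. z \<in> complex_roots p \<Longrightarrow> 4 * real S + 8 \<le> dist (complex_of_real y) z"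
  shows "\<bar>poly p y' * exp t' ^ i\<bar> \<le> exp (\<bar>y' - y\<bar> / 4 + i * (t' - t)) * \<bar>poly p y * exp t ^ i\<bar>"
proof -
  have "\<bar>poly p y'\<bar> \<le> exp (\<bar>y' - y\<bar> / 4) * \<bar>poly p y\<bar>"
    by (rule abs_poly_le_away_from_complex_roots [of "4 * real S + 8"]) (use assms in auto)
  then have "\<bar>poly p y'\<bar> * exp (i * t') \<le> exp (\<bar>y' - y\<bar> / 4) * \<bar>poly p y\<bar> * exp (i * t')"
    by (rule mult_right_mono) simp
  also have "\<dots> = exp (\<bar>y' - y\<bar> / 4 + i * (t' - t)) * (\<bar>poly p y\<bar> * exp (i * t))"
    by (simp add: exp_add exp_diff right_diff_distrib)
  finally show ?thesis by (simp add: abs_mult exp_of_nat_mult)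
qed

text \<open>Away from the roots of its coefficient, a term \<open>poly p y * exp t ^ i\<close> is essentially
  proportional to \<open>exp t ^ i\<close>, so that terms with distinct exponents drift apart.\<close>

lemma exp_terms_not_comparable_twice:
  fixes p q :: "real poly" and S i j :: nat and t t' y y' :: real
  assumes degree: "degree p \<le> S" "degree q \<le> S" and "i < j" and gap: "t + 4 * real S + 5 \<le> t'"
    and near: "\<bar>y - t\<bar> \<le> 2" "\<bar>y' - t'\<bar> \<le> 2"
    and far_p: "\<And>z. z \<in> complex_roots p \<Longrightarrow> 4 * real S + 8 \<le> dist (complex_of_real y) z"
    and far_q: "\<And>z. z \<in> complex_roots q \<Longrightarrow> 4 * real S + 8 \<le> dist (complex_of_real y') z"
    and comparable: "comparable (real S + 1) (poly p y * exp t ^ i) (poly q y * exp t ^ j)"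
      "comparable (real S + 1) (poly p y' * exp t' ^ i) (poly q y' * exp t' ^ j)"
  shows False
proof -
  define D where "D = \<bar>y' - y\<bar>"
  define s where "s = t' - t"
  define P where "P u v = \<bar>poly p u * exp v ^ i\<bar>" for u v
  define Q where "Q u v = \<bar>poly q u * exp v ^ j\<bar>" for u v
  have "D \<le> s + 4" and gap_s: "4 * real S + 5 \<le> s" using near gap by (simp_all add: D_def s_def)
  have "real S + 1 \<le> exp S" by (metis add.commute exp_ge_add_one_self)
  then have le_exp: "P y t \<le> exp S * Q y t" "Q y' t' \<le> exp S * P y' t'"
    using comparable [THEN comparable_mono] by (simp_all add: comparable_def P_def Q_def)
  have "Q y' t' \<le> exp S * P y' t'" by (rule le_exp)
  also have "\<dots> \<le> exp S * (exp (D / 4 + i * s) * P y t)"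
    unfolding P_def D_def s_def
    by (intro mult_left_mono abs_poly_times_exp_le [OF degree(1) far_p]) auto
  also have "\<dots> \<le> exp S * (exp (D / 4 + i * s) * (exp S * Q y t))"
    by (intro mult_left_mono le_exp) auto
  also have "\<dots> \<le> exp S * (exp (D / 4 + i * s) * (exp S * (exp (D / 4 + j * (- s)) * Q y' t')))"
    unfolding Q_def D_def s_def minus_diff_eq abs_minus_commute [of y' y]
    by (intro mult_left_mono abs_poly_times_exp_le [OF degree(2) far_q]) auto
  also have "\<dots> = exp (S + (D / 4 + i * s) + S + (D / 4 + j * (- s))) * Q y' t'"
    by (simp only: exp_add mult_ac)
  finally have "Q y' t' \<le> exp (S + (D / 4 + i * s) + S + (D / 4 + j * (- s))) * Q y' t'" .
  moreover have "Q y' t' > 0"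
    using far_q [of "of_real y'"] by (auto simp: Q_def of_real_in_complex_roots_iff)
  ultimately have "0 \<le> S + (D / 4 + i * s) + S + (D / 4 + j * (- s))" by simp
  then have "(real j - real i) * s \<le> 2 * S + D / 2" by (simp add: algebra_simps)
  moreover have "1 * s \<le> (real j - real i) * s"
    using \<open>i < j\<close> gap_s by (intro mult_right_mono) auto
  ultimately show False using \<open>D \<le> s + 4\<close> gap_s by linarith
qed

definition coeff_roots :: "real poly poly \<Rightarrow> complex set" where
  "coeff_roots p = (\<Union>i\<in>{i. coeff p i \<noteq> 0}. complex_roots (coeff p i))"

lemma
  assumes "degree p \<le> S" "\<And>i. degree (coeff p i) \<le> S"
  shows finite_coeff_roots: "finite (coeff_roots p)"
    and card_coeff_roots_le: "card (coeff_roots p) \<le> (S + 1) * S"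
proof -
  define A where "A = {i. coeff p i \<noteq> 0}"
  have "A \<subseteq> {..S}" using assms(1) by (auto simp: A_def intro: order_trans le_degree)
  then have "finite A" and "card A \<le> S + 1"
    using card_mono [of "{..S}" A] by (auto intro: finite_subset)
  then show "finite (coeff_roots p)"
    by (simp add: coeff_roots_def A_def finite_complex_roots)
  have "card (coeff_roots p) \<le> (\<Sum>i\<in>A. card (complex_roots (coeff p i)))"
    unfolding coeff_roots_def A_def [symmetric] by (rule card_UN_le [OF \<open>finite A\<close>])
  also have "\<dots> \<le> (\<Sum>i\<in>A. S)"
    by (intro sum_mono order_trans [OF card_complex_roots_le assms(2)]) (auto simp: A_def)
  also have "\<dots> \<le> (S + 1) * S" using mult_right_mono [OF \<open>card A \<le> S + 1\<close>, of S] by simp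
  finally show "card (coeff_roots p) \<le> (S + 1) * S" .
qed

lemma card_zeros_near_log_away_from_coeff_roots_le:
  fixes p :: "real poly poly" and S :: nat and y :: "real \<Rightarrow> real"
  assumes "p \<noteq> 0" and degree: "degree p \<le> S" "\<And>i. degree (coeff p i) \<le> S"
    and sep: "pairwise (\<lambda>s t. 4 * real S + 5 \<le> \<bar>s - t\<bar>) T"
    and near: "\<And>t. t \<in> T \<Longrightarrow> \<bar>y t - t\<bar> \<le> 2"
    and far: "\<And>t z. t \<in> T \<Longrightarrow> z \<in> coeff_roots p \<Longrightarrow> 4 * real S + 8 \<le> dist (complex_of_real (y t)) z"
    and zero: "\<And>t. t \<in> T \<Longrightarrow> poly (poly p [:exp t:]) (y t) = 0"
  shows "card T \<le> (S + 1) * (S + 1)"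
proof -
  define R where "R t = (\<lambda>(i, j). i < j \<and> coeff p i \<noteq> 0 \<and> coeff p j \<noteq> 0 \<and>
      comparable (real S + 1)
        (poly (coeff p i) (y t) * exp t ^ i) (poly (coeff p j) (y t) * exp t ^ j))"
    for t
  have far_coeff: "4 * real S + 8 \<le> dist (complex_of_real (y t)) z"
    if "t \<in> T" "coeff p i \<noteq> 0" "z \<in> complex_roots (coeff p i)" for t i z
    using far that by (auto simp: coeff_roots_def)
  have not_less: "\<not> s < t" if "s \<in> T" "t \<in> T" "R s (i, j)" "R t (i, j)" for s t i j
  proof
    assume "s < t"
    then have gap: "s + 4 * real S + 5 \<le> t" using pairwiseD [OF sep that(1,2)] by simp
    have "i < j" and nonzero: "coeff p i \<noteq> 0" "coeff p j \<noteq> 0" using that(3) by (simp_all add: R_def)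
    then show False
      using that by (intro exp_terms_not_comparable_twice [OF degree(2) degree(2) _ gap near near
            far_coeff [OF _ nonzero(1)] far_coeff [OF _ nonzero(2)]]) (auto simp: R_def)
  qed
  have "card T \<le> card ({..S} \<times> {..S})"
  proof (rule card_le_if_inj_on_rel [where r = R])
    fix t assume "t \<in> T"
    have "poly (coeff p i) (y t) \<noteq> 0" if "coeff p i \<noteq> 0" for i
      using far_coeff [OF \<open>t \<in> T\<close> that, of "of_real (y t)"]
      by (auto simp: of_real_in_complex_roots_iff)
    then obtain i j where "i < j" "j \<le> S" "R t (i, j)"
      by (rule poly_poly_eq_0_two_comparable
          [OF \<open>p \<noteq> 0\<close> degree(1) exp_not_eq_zero zero [OF \<open>t \<in> T\<close>]]) (auto simp: R_def)
    then show "\<exists>ij. ij \<in> {..S} \<times> {..S} \<and> R t ij"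
      by (intro exI [of _ "(i, j)"]) simp
  next
    fix s t ij
    assume "s \<in> T" "t \<in> T" "R s ij" "R t ij"
    then show "s = t"
      using not_less by (cases ij) (metis linorder_neqE_linordered_idom)
  qed auto
  then show ?thesis by simp
qed

text \<open>Each root of a coefficient spoils at most one \<open>t\<close>, since the points \<open>y t\<close> are far apart.\<close>

lemma card_zeros_near_log_le:
  fixes p :: "real poly poly" and S :: nat and y :: "real \<Rightarrow> real"
  assumes "p \<noteq> 0" and degree: "degree p \<le> S" "\<And>i. degree (coeff p i) \<le> S"
    and "finite T" and sep: "pairwise (\<lambda>s t. 8 * real S + 20 \<le> \<bar>s - t\<bar>) T"
    and near: "\<And>t. t \<in> T \<Longrightarrow> \<bar>y t - t\<bar> \<le> 2"
    and zero: "\<And>t. t \<in> T \<Longrightarrow> poly (poly p [:exp t:]) (y t) = 0"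
  shows "card T \<le> (S + 1) * (2 * S + 1)"
proof -
  define N where
    "N = {t \<in> T. \<exists>z\<in>coeff_roots p. dist (complex_of_real (y t)) z < 4 * real S + 8}"
  have "pairwise (\<lambda>s t. 2 * (4 * real S + 8) \<le> dist (complex_of_real (y s)) (of_real (y t))) T"
  proof (rule pairwiseI)
    fix s t assume "s \<in> T" "t \<in> T" "s \<noteq> t"
    then have "8 * real S + 20 \<le> \<bar>s - t\<bar>" "\<bar>y s - s\<bar> \<le> 2" "\<bar>y t - t\<bar> \<le> 2"
      using pairwiseD [OF sep] near by simp_all
    then show "2 * (4 * real S + 8) \<le> dist (complex_of_real (y s)) (of_real (y t))"
      unfolding dist_of_real dist_real_def by (smt (verit))
  qed
  then have "card N \<le> card (coeff_roots p)"
    unfolding N_def by (intro card_near_finite_set_le finite_coeff_roots [of p S] degree)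
  also have "\<dots> \<le> (S + 1) * S" by (intro card_coeff_roots_le degree)
  finally have "card N \<le> (S + 1) * S" .
  moreover have "card (T - N) \<le> (S + 1) * (S + 1)"
  proof (rule card_zeros_near_log_away_from_coeff_roots_le [OF \<open>p \<noteq> 0\<close> degree])
    show "pairwise (\<lambda>s t. 4 * real S + 5 \<le> \<bar>s - t\<bar>) (T - N)"
      using sep by (force simp: pairwise_def)
  qed (use near zero in \<open>auto simp: N_def not_less\<close>)
  moreover have "card T = card N + card (T - N)"
    using \<open>finite T\<close> by (simp add: N_def card_Diff_subset card_mono)
  ultimately show ?thesis by simp
qed

section \<open>Polynomial functions and elimination\<close>

interpretation fun_space: vector_space "\<lambda>c f x. c * f x :: 'b::field"
  by unfold_locales (simp_all add: fun_eq_iff algebra_simps)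

lemma sum_fun_apply: "(\<Sum>i\<in>I. f i) x = (\<Sum>i\<in>I. f i x)"
  by (induction I rule: infinite_finite_induct) simp_all

lemma times_in_fun_span:
  assumes "x \<in> fun_space.span B" and "\<And>b. b \<in> B \<Longrightarrow> (\<lambda>k. a k * b k) \<in> fun_space.span C"
  shows "(\<lambda>k. a k * x k) \<in> fun_space.span C"
  using assms(1)
proof (induction rule: fun_space.span_induct_alt)
  case base
  show ?case using fun_space.span_zero [of C] by (simp add: zero_fun_def)
next
  case (step c b y)
  have "(\<lambda>k. c * (a k * b k)) + (\<lambda>k. a k * y k) \<in> fun_space.span C"
    using step assms(2) by (intro fun_space.span_add fun_space.span_scale) auto
  then show ?case by (simp add: plus_fun_def algebra_simps)
qed

lemma (in vector_space) exists_nontrivial_relation: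
  assumes "finite I" "finite B" "card B < card I" and span: "f ` I \<subseteq> span B"
  shows "\<exists>c. (\<exists>i\<in>I. c i \<noteq> 0) \<and> (\<Sum>i\<in>I. scale (c i) (f i)) = 0"
proof (cases "inj_on f I")
  case True
  have "dependent (f ` I)"
    using independent_span_bound [OF \<open>finite B\<close> _ span] \<open>card B < card I\<close>
    by (auto simp: card_image [OF True])
  then obtain u where "\<exists>v\<in>f ` I. u v \<noteq> 0" "(\<Sum>v\<in>f ` I. scale (u v) v) = 0"
    using \<open>finite I\<close> by (auto simp: dependent_finite)
  then show ?thesis
    by (intro exI [of _ "u \<circ> f"]) (auto simp: sum.reindex [OF True])
next
  case False
  then obtain i j where ij: "i \<in> I" "j \<in> I" "i \<noteq> j" "f i = f j"
    by (auto simp: inj_on_def)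
  define c :: "_ \<Rightarrow> 'a" where "c = (\<lambda>_. 0)(i := 1, j := - 1)"
  have "(\<Sum>k\<in>I. scale (c k) (f k)) = (\<Sum>k\<in>{i, j}. scale (c k) (f k))"
    using ij \<open>finite I\<close> by (intro sum.mono_neutral_right) (auto simp: c_def)
  also have "\<dots> = 0" using ij by (simp add: c_def)
  finally show ?thesis using ij by (intro exI [of _ c]) (auto simp: c_def)
qed

inductive polyfun :: "'i set \<Rightarrow> nat \<Rightarrow> (('i \<Rightarrow> real) \<Rightarrow> real) \<Rightarrow> bool" for I :: "'i set" where
  const: "polyfun I d (\<lambda>_. c)"
| add: "polyfun I d f \<Longrightarrow> polyfun I d g \<Longrightarrow> polyfun I d (\<lambda>u. f u + g u)"
| coord: "i \<in> I \<Longrightarrow> polyfun I d f \<Longrightarrow> polyfun I (Suc d) (\<lambda>u. u i * f u)"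

lemma polyfun_Suc: "polyfun I d f \<Longrightarrow> polyfun I (Suc d) f"
  by (induction rule: polyfun.induct) (auto intro: polyfun.intros)

lemma polyfun_mono:
  assumes "polyfun I d f" "d \<le> e"
  shows "polyfun I e f"
  using assms(2,1) by (induction rule: dec_induct) (auto intro: polyfun_Suc)

lemma polyfun_mult:
  assumes "polyfun I d f" "polyfun I e g"
  shows "polyfun I (d + e) (\<lambda>u. f u * g u)"
  using assms(1)
proof (induction rule: polyfun.induct)
  case (const d c)
  have "polyfun I e (\<lambda>u. c * g u)"
    using assms(2)
  proof (induction rule: polyfun.induct)
    case (coord i e h)
    from polyfun.coord [OF coord(1,3)] show ?case by (simp add: mult_ac)
  qed (auto intro: polyfun.intros simp: distrib_left)
  then show ?case by (rule polyfun_mono) simp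
next
  case (add d f h)
  from polyfun.add [OF add.IH] show ?case by (simp add: distrib_right)
next
  case (coord i d f)
  from polyfun.coord [OF coord(1,3)] show ?case by (simp add: mult_ac)
qed

lemma polyfun_cmult: "polyfun I d f \<Longrightarrow> polyfun I d (\<lambda>u. c * f u)"
  using polyfun_mult [OF polyfun.const [of I 0 c]] by simp

lemma polyfun_diff: "polyfun I d f \<Longrightarrow> polyfun I d g \<Longrightarrow> polyfun I d (\<lambda>u. f u - g u)"
  using polyfun.add [of I d f, OF _ polyfun_cmult [of I d g "-1"]] by simp

lemma polyfun_proj: "i \<in> I \<Longrightarrow> polyfun I 1 (\<lambda>u. u i)"
  using polyfun.coord [OF _ polyfun.const [of I 0 1], of i] by simp

lemma polyfun_power: "polyfun I d f \<Longrightarrow> polyfun I (k * d) (\<lambda>u. f u ^ k)"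
  by (induction k) (auto intro: polyfun.const dest: polyfun_mult)

lemma polyfun_sum:
  "(\<And>k. k \<in> K \<Longrightarrow> polyfun I d (f k)) \<Longrightarrow> polyfun I d (\<lambda>u. \<Sum>k\<in>K. f k u)"
  by (induction K rule: infinite_finite_induct) (auto intro: polyfun.const polyfun.add)

lemma polyfun_prod:
  "(\<And>k. k \<in> K \<Longrightarrow> polyfun I (d k) (f k)) \<Longrightarrow> polyfun I (sum d K) (\<lambda>u. \<Prod>k\<in>K. f k u)"
  by (induction K rule: infinite_finite_induct) (auto intro: polyfun.const polyfun_mult)

lemma polyfun_continuous_on: "polyfun I d f \<Longrightarrow> continuous_on S f"
proof (induction rule: polyfun.induct)
  case (coord i d f)
  then show ?case
    by (intro continuous_on_mult continuous_on_subset [OF continuous_on_product_coordinates]) auto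
qed (auto intro: continuous_on_const continuous_on_add)

lemma polyfun_0_imp_const: "polyfun I 0 f \<Longrightarrow> \<exists>c. f = (\<lambda>_. c)"
  by (induction "0::nat" f rule: polyfun.induct) auto

lemma polyfun_has_partial_derivative:
  assumes "polyfun I (Suc d) f"
  shows "\<exists>g. polyfun I d g \<and> (\<forall>u. ((\<lambda>s. f (u(i := s))) has_real_derivative g u) (at (u i)))"
  using assms
proof (induction "Suc d" f arbitrary: d rule: polyfun.induct)
  case (const c)
  show ?case by (intro exI [of _ "\<lambda>_. 0"]) (simp add: polyfun.const)
next
  case (add f h)
  then obtain f' h' where "polyfun I d f'" "polyfun I d h'"
    and "\<And>u. ((\<lambda>s. f (u(i := s))) has_real_derivative f' u) (at (u i))"
      "\<And>u. ((\<lambda>s. h (u(i := s))) has_real_derivative h' u) (at (u i))"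
    by metis
  then show ?case
    by (intro exI [of _ "\<lambda>u. f' u + h' u"]) (auto intro: DERIV_add polyfun.add)
next
  case (coord j d f)
  define c :: real where "c = (if j = i then 1 else 0)"
  have proj: "((\<lambda>s. (u(i := s)) j) has_real_derivative c) (at (u i))" for u :: "'a \<Rightarrow> real"
    by (cases "j = i") (auto simp: c_def)
  obtain f' where f': "polyfun I d (\<lambda>u. u j * f' u)"
    "\<And>u. ((\<lambda>s. f (u(i := s))) has_real_derivative f' u) (at (u i))"
  proof (cases d)
    case 0
    with coord(2) obtain b where "f = (\<lambda>_. b)" using polyfun_0_imp_const by blast
    then show ?thesis using that [of "\<lambda>_. 0"] by (simp add: polyfun.const)
  next
    case (Suc e)
    with coord(3) show ?thesis using that polyfun.coord [OF coord(1)] by blast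
  qed
  have "((\<lambda>s. (u(i := s)) j * f (u(i := s))) has_real_derivative (c * f u + u j * f' u)) (at (u i))"
    for u
    using DERIV_mult [OF proj [of u] f'(2) [of u]] by (simp add: mult.commute)
  moreover have "polyfun I d (\<lambda>u. c * f u + u j * f' u)"
    by (intro polyfun.add polyfun_cmult coord f')
  ultimately show ?case
    by (intro exI [of _ "\<lambda>u. c * f u + u j * f' u"]) (simp del: fun_upd_apply)
qed

definition monomial :: "'i set \<Rightarrow> ('i \<Rightarrow> nat) \<Rightarrow> ('i \<Rightarrow> real) \<Rightarrow> real" where
  "monomial I \<beta> u = (\<Prod>i\<in>I. u i ^ \<beta> i)"

lemma power_times_monomial_upd:
  assumes "finite I" "i \<in> I"
  shows "u i ^ k * monomial I (\<beta>(i := l)) u = monomial I (\<beta>(i := k + l)) u"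
proof -
  have "monomial I (\<beta>(i := l)) u = u i ^ l * monomial (I - {i}) \<beta> u" for l
    unfolding monomial_def using assms by (subst prod.remove [of _ i]) auto
  then show ?thesis by (simp add: power_add mult.assoc)
qed

lemma sum_upd:
  fixes \<beta> :: "'i \<Rightarrow> nat"
  assumes "finite I" "i \<in> I"
  shows "sum (\<beta>(i := k)) I + \<beta> i = sum \<beta> I + k"
  using assms by (simp add: sum.remove [of I i])

lemma polyfun_monomial: "polyfun I (sum \<beta> I) (monomial I \<beta>)"
proof -
  have "polyfun I (\<Sum>i\<in>I. \<beta> i * 1) (monomial I \<beta>)"
    unfolding monomial_def [abs_def] by (intro polyfun_prod polyfun_power polyfun_proj)
  then show ?thesis by simp
qed

lemma polyfun_times_monomial_upd_0:
  assumes "finite I" "i \<in> I" "polyfun I (\<beta> i) g" "sum \<beta> I \<le> d"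
  shows "polyfun I d (\<lambda>u. g u * monomial I (\<beta>(i := 0)) u)"
proof (rule polyfun_mono)
  show "polyfun I (\<beta> i + sum (\<beta>(i := 0)) I) (\<lambda>u. g u * monomial I (\<beta>(i := 0)) u)"
    by (intro polyfun_mult assms polyfun_monomial)
  show "\<beta> i + sum (\<beta>(i := 0)) I \<le> d"
    using sum_upd [OF assms(1,2), of \<beta> 0] assms(4) by linarith
qed

text \<open>The coordinate \<open>p\<close> is the parameter of a system \<open>u i ^ Suc r = g i u\<close>, \<open>i \<in> J\<close>, with \<open>g i\<close> of
  degree \<open>r\<close>: the exponents in \<open>J\<close> can be brought down to \<open>r\<close>, as each substitution lowers the total
  degree.\<close>

definition reduced_monomials :: "'i \<Rightarrow> 'i set \<Rightarrow> nat \<Rightarrow> nat \<Rightarrow> (('i \<Rightarrow> real) \<Rightarrow> real) set" where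
  "reduced_monomials p J r d =
     monomial (insert p J) ` {\<beta>. (\<forall>i\<in>J. \<beta> i \<le> r) \<and> sum \<beta> (insert p J) \<le> d}"

lemma
  assumes "finite J" "p \<notin> J"
  shows finite_reduced_monomials: "finite (reduced_monomials p J r d)"
    and card_reduced_monomials_le: "card (reduced_monomials p J r d) \<le> (d + 1) * (r + 1) ^ card J"
proof -
  define X where "X = (\<Pi>\<^sub>E i\<in>insert p J. if i = p then {..d} else {..r})"
  have "finite X" unfolding X_def using assms by (intro finite_PiE) auto
  have subset: "reduced_monomials p J r d \<subseteq> monomial (insert p J) ` X"
  proof
    fix h assume "h \<in> reduced_monomials p J r d"
    then obtain \<beta> where h: "h = monomial (insert p J) \<beta>"
      and \<beta>: "\<forall>i\<in>J. \<beta> i \<le> r" "sum \<beta> (insert p J) \<le> d"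
      by (auto simp: reduced_monomials_def)
    have "\<beta> p \<le> d" using \<beta>(2) assms by simp
    with \<beta>(1) have "restrict \<beta> (insert p J) \<in> X" by (auto simp: X_def)
    moreover have "h = monomial (insert p J) (restrict \<beta> (insert p J))"
      unfolding h by (simp add: monomial_def [abs_def])
    ultimately show "h \<in> monomial (insert p J) ` X" by blast
  qed
  then show "finite (reduced_monomials p J r d)"
    using \<open>finite X\<close> by (auto intro: finite_subset)
  have "card (reduced_monomials p J r d) \<le> card X"
    using subset \<open>finite X\<close> by (meson card_image_le card_mono finite_imageI order_trans)
  also have "\<dots> = (\<Prod>i\<in>insert p J. if i = p then d + 1 else r + 1)"
    unfolding X_def using assms
    by (simp add: card_PiE if_distrib [of card] del: prod.insert cong: if_cong)
  also have "\<dots> = (d + 1) * (\<Prod>i\<in>J. if i = p then d + 1 else r + 1)"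
    using assms by simp
  also have "(\<Prod>i\<in>J. if i = p then d + 1 else r + 1) = (\<Prod>i\<in>J. r + 1)"
    using assms by (intro prod.cong) auto
  finally show "card (reduced_monomials p J r d) \<le> (d + 1) * (r + 1) ^ card J" by simp
qed

lemma reduced_monomials_mono: "d \<le> e \<Longrightarrow> reduced_monomials p J r d \<subseteq> reduced_monomials p J r e"
  unfolding reduced_monomials_def by (intro image_mono) auto

text \<open>Composition with \<open>u\<close> restricts polynomial functions to the solutions \<open>u k\<close> of the system.\<close>

definition reduced_span ::
    "('k \<Rightarrow> 'i \<Rightarrow> real) \<Rightarrow> 'i \<Rightarrow> 'i set \<Rightarrow> nat \<Rightarrow> nat \<Rightarrow> ('k \<Rightarrow> real) set" where
  "reduced_span u p J r d = fun_space.span ((\<lambda>h. h \<circ> u) ` reduced_monomials p J r d)"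

lemma coord_times_reduced_monomial_in_reduced_span:
  fixes u :: "'k \<Rightarrow> 'i \<Rightarrow> real"
  assumes "finite J" and i: "i \<in> insert p J"
    and g: "\<And>i. i \<in> J \<Longrightarrow> polyfun (insert p J) r (g i)"
    and u: "\<And>k i. i \<in> J \<Longrightarrow> u k i ^ Suc r = g i (u k)"
    and same_degree: "\<And>f. polyfun (insert p J) d f \<Longrightarrow> f \<circ> u \<in> reduced_span u p J r d"
    and h: "h \<in> reduced_monomials p J r d"
  shows "(\<lambda>k. u k i * h (u k)) \<in> reduced_span u p J r (Suc d)"
proof -
  let ?I = "insert p J"
  have "finite ?I" using \<open>finite J\<close> by simp
  obtain \<beta> where h: "h = monomial ?I \<beta>" and \<beta>: "\<forall>i\<in>J. \<beta> i \<le> r" "sum \<beta> ?I \<le> d"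
    using h by (auto simp: reduced_monomials_def)
  let ?h = "monomial ?I (\<beta>(i := Suc (\<beta> i)))"
  have "?h \<circ> u \<in> reduced_span u p J r (Suc d)"
  proof (cases "i \<in> J \<and> \<beta> i = r")
    case False
    then have "\<forall>k\<in>J. (\<beta>(i := Suc (\<beta> i))) k \<le> r"
      using \<beta>(1) by (auto simp: Suc_le_eq le_neq_implies_less)
    moreover have "sum (\<beta>(i := Suc (\<beta> i))) ?I \<le> Suc d"
      using sum_upd [OF \<open>finite ?I\<close> i, of \<beta> "Suc (\<beta> i)"] \<beta>(2) by linarith
    ultimately have "?h \<in> reduced_monomials p J r (Suc d)"
      unfolding reduced_monomials_def by blast
    then show ?thesis
      unfolding reduced_span_def by (intro fun_space.span_base imageI)
  next
    case True
    let ?f = "\<lambda>u. g i u * monomial ?I (\<beta>(i := 0)) u"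
    have "?f \<circ> u \<in> reduced_span u p J r d"
      using True by (intro same_degree polyfun_times_monomial_upd_0 \<open>finite ?I\<close> i \<beta>) (simp add: g)
    also have "?f \<circ> u = ?h \<circ> u"
    proof
      fix k
      have "g i (u k) = u k i ^ Suc r" using True by (simp only: u)
      then show "(?f \<circ> u) k = (?h \<circ> u) k"
        using True power_times_monomial_upd [OF \<open>finite ?I\<close> i, where k = "Suc r" and l = 0] by simp
    qed
    also have "reduced_span u p J r d \<subseteq> reduced_span u p J r (Suc d)"
      unfolding reduced_span_def
      by (intro fun_space.span_mono image_mono reduced_monomials_mono) simp
    finally show ?thesis .
  qed
  also have "?h \<circ> u = (\<lambda>k. u k i * h (u k))"
    using power_times_monomial_upd [OF \<open>finite ?I\<close> i, where k = 1 and \<beta> = \<beta> and l = "\<beta> i"]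
    by (simp add: fun_eq_iff h)
  finally show ?thesis .
qed

lemma polyfun_in_reduced_span:
  fixes u :: "'k \<Rightarrow> 'i \<Rightarrow> real"
  assumes "finite J"
    and g: "\<And>i. i \<in> J \<Longrightarrow> polyfun (insert p J) r (g i)"
    and u: "\<And>k i. i \<in> J \<Longrightarrow> u k i ^ Suc r = g i (u k)"
    and "polyfun (insert p J) d f"
  shows "f \<circ> u \<in> reduced_span u p J r d"
  using assms(4)
proof (induction d arbitrary: f rule: less_induct)
  case (less d)
  from less.prems less.IH show ?case
  proof (induction rule: polyfun.induct)
    case (const d c)
    have "monomial (insert p J) (\<lambda>_. 0) \<in> reduced_monomials p J r d"
      unfolding reduced_monomials_def by (intro imageI) simp
    then have "(\<lambda>k. c * (monomial (insert p J) (\<lambda>_. 0) \<circ> u) k) \<in> reduced_span u p J r d"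
      unfolding reduced_span_def by (intro fun_space.span_scale fun_space.span_base imageI)
    then show ?case by (simp add: monomial_def [abs_def] comp_def)
  next
    case (add d f h)
    then have "(f \<circ> u) + (h \<circ> u) \<in> reduced_span u p J r d"
      unfolding reduced_span_def by (metis fun_space.span_add)
    then show ?case by (simp add: plus_fun_def comp_def)
  next
    case (coord i d f)
    have same_degree: "f \<circ> u \<in> reduced_span u p J r d" if "polyfun (insert p J) d f" for f
      using coord.prems that by blast
    have "(\<lambda>k. u k i * (f \<circ> u) k) \<in> reduced_span u p J r (Suc d)"
      unfolding reduced_span_def
    proof (rule times_in_fun_span [OF same_degree [OF coord.hyps(2), unfolded reduced_span_def]])
      fix b assume "b \<in> (\<lambda>h. h \<circ> u) ` reduced_monomials p J r d"
      then show "(\<lambda>k. u k i * b k) \<in> fun_space.span ((\<lambda>h. h \<circ> u) ` reduced_monomials p J r (Suc d))"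
        using coord_times_reduced_monomial_in_reduced_span
          [OF \<open>finite J\<close> coord.hyps(1) g u same_degree]
        by (auto simp: reduced_span_def)
    qed
    then show ?case by (simp add: comp_def)
  qed
qed

definition bivariate_poly :: "nat \<Rightarrow> (nat \<times> nat \<Rightarrow> 'a::comm_ring_1) \<Rightarrow> 'a poly poly" where
  "bivariate_poly n c = (\<Sum>i\<le>n. monom (\<Sum>j\<le>n. monom (c (i, j)) j) i)"

lemma coeff_bivariate_poly:
  "coeff (bivariate_poly n c) i = (if i \<le> n then \<Sum>j\<le>n. monom (c (i, j)) j else 0)"
  by (simp add: bivariate_poly_def coeff_sum)

lemma degree_bivariate_poly_le: "degree (bivariate_poly n c) \<le> n"
  unfolding bivariate_poly_def by (intro degree_sum_le order_trans [OF degree_monom_le]) auto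

lemma degree_coeff_bivariate_poly_le: "degree (coeff (bivariate_poly n c) i) \<le> n"
  unfolding coeff_bivariate_poly by (auto intro!: degree_sum_le order_trans [OF degree_monom_le])

lemma bivariate_poly_nonzero:
  assumes "ij \<in> {..n} \<times> {..n}" "c ij \<noteq> 0"
  shows "bivariate_poly n c \<noteq> 0"
proof
  assume "bivariate_poly n c = 0"
  then have "coeff (coeff (bivariate_poly n c) (fst ij)) (snd ij) = 0" by simp
  with assms show False by (auto simp: coeff_bivariate_poly coeff_sum)
qed

lemma poly_poly_bivariate_poly:
  "poly (poly (bivariate_poly n c) [:x:]) y = (\<Sum>ij\<in>{..n} \<times> {..n}. c ij * (x ^ fst ij * y ^ snd ij))"
  by (simp add: bivariate_poly_def poly_sum poly_monom poly_power sum_distrib_left mult_ac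
      sum.cartesian_product case_prod_beta)

lemma exists_bivariate_relation:
  fixes u :: "'k \<Rightarrow> 'i \<Rightarrow> real"
  assumes "finite J" "p \<notin> J" and j: "j \<in> insert p J"
    and g: "\<And>i. i \<in> J \<Longrightarrow> polyfun (insert p J) r (g i)"
    and u: "\<And>k i. i \<in> J \<Longrightarrow> u k i ^ Suc r = g i (u k)"
  defines "S \<equiv> 2 * (r + 1) ^ card J"
  obtains P :: "real poly poly" where "P \<noteq> 0" "degree P \<le> S" "\<And>a. degree (coeff P a) \<le> S"
    "\<And>k. poly (poly P [:u k p:]) (u k j) = 0"
proof -
  let ?I = "insert p J"
  define B where "B = (\<lambda>h. h \<circ> u) ` reduced_monomials p J r (2 * S)"
  define F where "F ab k = u k p ^ fst ab * u k j ^ snd ab" for ab k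
  have "finite B"
    unfolding B_def by (intro finite_imageI finite_reduced_monomials assms)
  have "card B \<le> (2 * S + 1) * (r + 1) ^ card J"
    unfolding B_def using assms(1,2)
    by (meson card_image_le card_reduced_monomials_le finite_reduced_monomials order_trans)
  also have "\<dots> < (S + 1) * (S + 1)" by (simp add: S_def algebra_simps)
  finally have "card B < card ({..S} \<times> {..S})" by simp
  moreover have "F ` ({..S} \<times> {..S}) \<subseteq> fun_space.span B"
  proof
    fix f assume "f \<in> F ` ({..S} \<times> {..S})"
    then obtain a b where "f = F (a, b)" "a \<le> S" "b \<le> S" by auto
    have "polyfun ?I (a * 1 + b * 1) (\<lambda>v. v p ^ a * v j ^ b)"
      by (intro polyfun_mult polyfun_power polyfun_proj j) simp
    then have "polyfun ?I (2 * S) (\<lambda>v. v p ^ a * v j ^ b)"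
      by (rule polyfun_mono) (use \<open>a \<le> S\<close> \<open>b \<le> S\<close> in simp)
    from polyfun_in_reduced_span [OF \<open>finite J\<close> g u this]
    show "f \<in> fun_space.span B"
      by (simp add: \<open>f = F (a, b)\<close> reduced_span_def B_def F_def [abs_def] comp_def)
  qed
  ultimately obtain c where c: "\<exists>ab\<in>{..S} \<times> {..S}. c ab \<noteq> 0"
    and sum_eq_0: "(\<Sum>ab\<in>{..S} \<times> {..S}. (\<lambda>k. c ab * F ab k)) = 0"
    using fun_space.exists_nontrivial_relation [OF _ \<open>finite B\<close>, of "{..S} \<times> {..S}" F] by auto
  show ?thesis
  proof (rule that)
    show "bivariate_poly S c \<noteq> 0" using c bivariate_poly_nonzero by blast
    fix k
    show "poly (poly (bivariate_poly S c) [:u k p:]) (u k j) = 0"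
      using fun_cong [OF sum_eq_0, of k]
      by (simp add: poly_poly_bivariate_poly sum_fun_apply F_def)
  qed (rule degree_bivariate_poly_le degree_coeff_bivariate_poly_le)+
qed

section \<open>Penalised minimisation\<close>

lemma compact_Pi_UNIV:
  fixes X :: "'i \<Rightarrow> 'a::topological_space set"
  assumes "\<And>i. compact (X i)"
  shows "compact {u. \<forall>i. u i \<in> X i}"
proof -
  have "compactin (product_topology (\<lambda>i. euclidean) UNIV) (PiE UNIV X)"
    using assms by (simp add: compactin_PiE)
  moreover have "PiE UNIV X = {u. \<forall>i. u i \<in> X i}" by (auto simp: PiE_iff)
  ultimately show ?thesis by (simp add: euclidean_product_topology)
qed

lemma compact_obtains_pos_lower_bound:
  fixes f :: "'a::topological_space \<Rightarrow> real"
  assumes "compact T" "continuous_on T f" "\<And>x. x \<in> T \<Longrightarrow> 0 < f x"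
  obtains e where "e > 0" "\<And>x. x \<in> T \<Longrightarrow> e \<le> f x"
proof (cases "T = {}")
  case False
  then obtain w where "w \<in> T" "\<And>x. x \<in> T \<Longrightarrow> f w \<le> f x"
    using continuous_attains_inf [OF assms(1) _ assms(2)] by blast
  then show ?thesis using that assms(3) by blast
qed (use that [of 1] in simp)

definition agreeing_off :: "'i set \<Rightarrow> ('i \<Rightarrow> 'a) \<Rightarrow> ('i \<Rightarrow> 'a) set" where
  "agreeing_off J v = {u. \<forall>i. i \<notin> J \<longrightarrow> u i = v i}"

lemma agreeing_off_refl: "v \<in> agreeing_off J v"
  by (simp add: agreeing_off_def)

definition agreeing_off_box :: "'i set \<Rightarrow> ('i \<Rightarrow> real) \<Rightarrow> real \<Rightarrow> ('i \<Rightarrow> real) set" where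
  "agreeing_off_box J v R = {u \<in> agreeing_off J v. \<forall>i\<in>J. \<bar>u i\<bar> \<le> R}"

lemma compact_agreeing_off_box: "compact (agreeing_off_box J v R)"
proof -
  have "agreeing_off_box J v R = {u. \<forall>i. u i \<in> (if i \<in> J then {-R..R} else {v i})}"
    by (auto simp: agreeing_off_box_def agreeing_off_def abs_le_iff minus_le_iff)
  also have "compact \<dots>" by (rule compact_Pi_UNIV) simp
  finally show ?thesis .
qed

lemma linear_le_even_power:
  fixes x \<mu> :: real
  assumes "\<mu> > 0"
  shows "x \<le> \<mu> * x ^ (2 * l + 2) + max 1 (1 / \<mu>)"
proof (cases "x \<le> max 1 (1 / \<mu>)")
  case True
  have "0 \<le> \<mu> * x ^ (2 * l + 2)"
    using \<open>\<mu> > 0\<close> by (intro mult_nonneg_nonneg zero_le_even_power) auto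
  with True show ?thesis by simp
next
  case False
  then have "1 \<le> x" and "1 / \<mu> \<le> x" by auto
  then have "1 / \<mu> \<le> x ^ (2 * l + 1)" using self_le_power [of x "2 * l + 1"] by linarith
  then have "1 \<le> \<mu> * x ^ (2 * l + 1)" using \<open>\<mu> > 0\<close> by (simp add: field_simps)
  then have "1 * x \<le> \<mu> * x ^ (2 * l + 1) * x"
    using \<open>1 \<le> x\<close> by (intro mult_right_mono) auto
  then show ?thesis by (simp add: mult_ac)
qed

text \<open>The even powers make the minimisation coercive, and they turn the critical equations of a
  defect \<open>E\<close> of degree at most \<open>2 * l + 1\<close> into \<open>u i ^ (2 * l + 1) =\<close> lower order terms.\<close>

locale penalised_maximisation =
  fixes J :: "'i set" and j :: 'i and l :: nat and E :: "('i \<Rightarrow> real) \<Rightarrow> real"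
  assumes finite_J: "finite J" and j_in_J: "j \<in> J"
    and continuous_E: "continuous_on UNIV E" and E_nonneg: "\<And>u. 0 \<le> E u"
begin

definition penalty :: "('i \<Rightarrow> real) \<Rightarrow> real" where
  "penalty u = (\<Sum>i\<in>J. u i ^ (2 * l + 2))"

definition objective :: "real \<Rightarrow> real \<Rightarrow> ('i \<Rightarrow> real) \<Rightarrow> real" where
  "objective \<mu> A u = A * E u + \<mu> * penalty u - u j"

lemma penalty_nonneg: "0 \<le> penalty u"
  unfolding penalty_def by (intro sum_nonneg zero_le_even_power) simp

lemma even_power_le_penalty: "i \<in> J \<Longrightarrow> u i ^ (2 * l + 2) \<le> penalty u"
  unfolding penalty_def using finite_J by (intro member_le_sum zero_le_even_power) auto

lemma continuous_objective: "continuous_on S (objective \<mu> A)"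
  unfolding objective_def penalty_def
  by (intro continuous_intros continuous_on_subset [OF continuous_E]
      continuous_on_subset [OF continuous_on_product_coordinates]) auto

definition radius :: "real \<Rightarrow> real \<Rightarrow> real" where
  "radius \<mu> c = max 1 (2 * (c + max 1 (2 / \<mu>)) / \<mu>)"

lemma objective_coercive:
  assumes "\<mu> > 0" "A \<ge> 0" and objective_le: "objective \<mu> A u \<le> c" and "i \<in> J"
  shows "\<bar>u i\<bar> \<le> radius \<mu> c"
proof -
  have "u j \<le> \<mu> / 2 * u j ^ (2 * l + 2) + max 1 (2 / \<mu>)"
    using linear_le_even_power [of "\<mu> / 2" "u j" l] \<open>\<mu> > 0\<close> by simp
  also have "\<dots> \<le> \<mu> / 2 * penalty u + max 1 (2 / \<mu>)"
    using even_power_le_penalty [OF j_in_J] \<open>\<mu> > 0\<close> by (intro add_right_mono mult_left_mono) auto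
  finally have "\<mu> * penalty u - u j \<ge> \<mu> / 2 * penalty u - max 1 (2 / \<mu>)" by simp
  moreover have "\<mu> * penalty u - u j \<le> c"
    using objective_le mult_nonneg_nonneg [OF \<open>A \<ge> 0\<close> E_nonneg [of u]] by (simp add: objective_def)
  ultimately have "\<mu> / 2 * penalty u \<le> c + max 1 (2 / \<mu>)" by linarith
  then have "penalty u \<le> 2 * (c + max 1 (2 / \<mu>)) / \<mu>"
    using \<open>\<mu> > 0\<close> by (simp add: field_simps)
  moreover have "\<bar>u i\<bar> ^ (2 * l + 2) \<le> penalty u"
    using even_power_le_penalty [OF \<open>i \<in> J\<close>, of u] by (simp add: power_even_abs)
  ultimately show ?thesis
    using self_le_power [of "\<bar>u i\<bar>" "2 * l + 2"] unfolding radius_def by linarith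
qed

lemma objective_attains_min:
  assumes "\<mu> > 0" "A \<ge> 0"
  obtains u where "u \<in> agreeing_off J v"
    "\<And>w. w \<in> agreeing_off J v \<Longrightarrow> objective \<mu> A u \<le> objective \<mu> A w"
proof -
  define c where "c = objective \<mu> A v"
  define box where "box = agreeing_off_box J v (radius \<mu> c)"
  have in_box: "w \<in> box" if "w \<in> agreeing_off J v" "objective \<mu> A w \<le> c" for w
    using objective_coercive [OF assms that(2)] that(1)
    by (simp add: box_def agreeing_off_box_def)
  then have "v \<in> box" by (simp add: c_def agreeing_off_refl)
  moreover have "compact box" unfolding box_def by (rule compact_agreeing_off_box)
  ultimately obtain u where "u \<in> box" and u: "\<And>w. w \<in> box \<Longrightarrow> objective \<mu> A u \<le> objective \<mu> A w"
    using continuous_attains_inf [of box "objective \<mu> A"] continuous_objective by blast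
  have "objective \<mu> A u \<le> objective \<mu> A w" if "w \<in> agreeing_off J v" for w
    using u [of w] u [OF \<open>v \<in> box\<close>] in_box [OF that] unfolding c_def by linarith
  with \<open>u \<in> box\<close> show ?thesis by (intro that) (auto simp: box_def agreeing_off_box_def)
qed

lemma defect_bound_of_objective_le:
  assumes "\<mu> > 0" "E v = 0" "\<mu> * penalty v \<le> \<delta>" and "objective \<mu> A u \<le> objective \<mu> A v"
  shows "A * E u - u j \<le> \<delta> - v j"
proof -
  have "0 \<le> \<mu> * penalty u" using \<open>\<mu> > 0\<close> penalty_nonneg by simp
  then show ?thesis using assms(2-4) by (simp add: objective_def)
qed

lemma minimiser_coordinate_bounds:
  assumes "\<mu> > 0" "\<delta> > 0" and v: "E v = 0" "\<mu> * penalty v \<le> \<delta>"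
    and upper: "\<And>u. u \<in> agreeing_off J v \<Longrightarrow> E u = 0 \<Longrightarrow> u j \<le> Y"
  shows "\<forall>\<^sub>F A in at_top. \<forall>u\<in>agreeing_off J v. objective \<mu> A u \<le> objective \<mu> A v \<longrightarrow>
    v j - \<delta> \<le> u j \<and> u j \<le> Y + \<delta>"
proof -
  define c where "c = \<delta> - v j"
  define R where "R = radius \<mu> c"
  define T where "T = agreeing_off_box J v R \<inter> {u. Y + \<delta> \<le> u j}"
  have "closed {u :: 'i \<Rightarrow> real. Y + \<delta> \<le> u j}"
    by (intro closed_Collect_le continuous_intros continuous_on_product_coordinates)
  then have "compact T"
    unfolding T_def by (intro compact_Int_closed compact_agreeing_off_box)
  then obtain e where "e > 0" and e: "\<And>u. u \<in> T \<Longrightarrow> e \<le> E u"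
  proof (rule compact_obtains_pos_lower_bound)
    show "continuous_on T E" using continuous_E by (rule continuous_on_subset) simp
    show "0 < E u" if "u \<in> T" for u
      using upper [of u] that \<open>\<delta> > 0\<close> E_nonneg [of u]
      by (fastforce simp: T_def agreeing_off_box_def)
  qed blast
  have "v j - \<delta> \<le> u j \<and> u j \<le> Y + \<delta>"
    if A: "0 \<le> A" "(c + R) / e < A"
      and u: "u \<in> agreeing_off J v" "objective \<mu> A u \<le> objective \<mu> A v" for A u
  proof -
    have defect_bound: "A * E u - u j \<le> c"
      unfolding c_def by (rule defect_bound_of_objective_le [OF \<open>\<mu> > 0\<close> v u(2)])
    have objective_le: "objective \<mu> A u \<le> c"
      using u(2) v by (simp add: objective_def c_def)
    have le_R: "\<bar>u i\<bar> \<le> R" if "i \<in> J" for i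
      unfolding R_def by (rule objective_coercive [OF \<open>\<mu> > 0\<close> A(1) objective_le that])
    have "u j \<le> Y + \<delta>"
    proof (rule ccontr)
      assume "\<not> ?thesis"
      then have "u \<in> T" using u(1) le_R by (simp add: T_def agreeing_off_box_def)
      have "c + R < A * e" using A(2) \<open>e > 0\<close> by (simp add: field_simps)
      also have "\<dots> \<le> A * E u" using e [OF \<open>u \<in> T\<close>] A(1) by (rule mult_left_mono)
      finally show False using defect_bound le_R [OF j_in_J] by linarith
    qed
    moreover have "v j - \<delta> \<le> u j"
      using defect_bound mult_nonneg_nonneg [OF A(1) E_nonneg [of u]] by (simp add: c_def)
    ultimately show ?thesis by simp
  qed
  moreover have "\<forall>\<^sub>F A in at_top. 0 \<le> A \<and> (c + R) / e < A"
    by (intro eventually_conj eventually_ge_at_top eventually_gt_at_top)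
  ultimately show ?thesis by (auto elim: eventually_mono)
qed

lemma critical_equation:
  fixes u :: "'i \<Rightarrow> real"
  assumes "((\<lambda>s. E (u(i := s))) has_real_derivative D) (at (u i))"
    and "\<mu> > 0" "i \<in> J" and min: "\<And>w. w \<in> agreeing_off J u \<Longrightarrow> objective \<mu> A u \<le> objective \<mu> A w"
  shows "u i ^ (2 * l + 1) = 1 / (\<mu> * (2 * l + 2)) * (of_bool (i = j) - A * D)"
proof -
  define S where "S = (\<Sum>k\<in>J - {i}. u k ^ (2 * l + 2))"
  have penalty_upd: "penalty (u(i := s)) = s ^ (2 * l + 2) + S" for s
    unfolding penalty_def S_def using finite_J \<open>i \<in> J\<close>
    by (subst sum.remove [of _ i]) (auto intro!: sum.cong simp del: power_Suc)
  have "((\<lambda>s. (u(i := s)) j) has_real_derivative of_bool (i = j)) (at (u i))"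
    by (cases "i = j") auto
  moreover have "((\<lambda>s. s ^ (2 * l + 2) + S) has_real_derivative
      (2 * l + 2) * u i ^ (2 * l + 1)) (at (u i))"
    using DERIV_add [OF DERIV_pow [of "2 * l + 2" "u i"] DERIV_const] by simp
  ultimately have "((\<lambda>s. objective \<mu> A (u(i := s))) has_real_derivative
      A * D + \<mu> * ((2 * l + 2) * u i ^ (2 * l + 1)) - of_bool (i = j)) (at (u i))"
    unfolding objective_def penalty_upd by (intro DERIV_diff DERIV_add DERIV_cmult assms(1))
  then have "A * D + \<mu> * ((2 * l + 2) * u i ^ (2 * l + 1)) - of_bool (i = j) = 0"
  proof (rule DERIV_local_min [of _ _ _ 1])
    have "u(i := s) \<in> agreeing_off J u" for s using \<open>i \<in> J\<close> by (simp add: agreeing_off_def)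
    then show "\<forall>s. \<bar>u i - s\<bar> < 1 \<longrightarrow> objective \<mu> A (u(i := u i)) \<le> objective \<mu> A (u(i := s))"
      using min by simp
  qed simp
  moreover have "\<mu> * (2 * l + 2) \<noteq> 0" using \<open>\<mu> > 0\<close> by simp
  ultimately show ?thesis
    by (simp add: nonzero_eq_divide_eq mult_ac del: power_Suc)
qed

lemma exists_uniform_penalty:
  assumes "finite T" "\<delta> > 0" and v: "\<And>t. t \<in> T \<Longrightarrow> E (v t) = 0"
    and upper: "\<And>t u. t \<in> T \<Longrightarrow> u \<in> agreeing_off J (v t) \<Longrightarrow> E u = 0 \<Longrightarrow> u j \<le> Y t"
  obtains \<mu> A where "\<mu> > 0" "A \<ge> 0"
    "\<And>t u. t \<in> T \<Longrightarrow> u \<in> agreeing_off J (v t) \<Longrightarrow> objective \<mu> A u \<le> objective \<mu> A (v t) \<Longrightarrow>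
       v t j - \<delta> \<le> u j \<and> u j \<le> Y t + \<delta>"
proof -
  define \<mu> where "\<mu> = \<delta> / (1 + (\<Sum>t\<in>T. penalty (v t)))"
  have sum_penalty_nonneg: "0 \<le> (\<Sum>t\<in>T. penalty (v t))" by (intro sum_nonneg penalty_nonneg)
  then have "\<mu> > 0" using \<open>\<delta> > 0\<close> by (simp add: \<mu>_def)
  have "\<mu> * penalty (v t) \<le> \<delta>" if "t \<in> T" for t
  proof -
    have "penalty (v t) \<le> 1 + (\<Sum>t\<in>T. penalty (v t))"
      using member_le_sum [OF that, of "\<lambda>t. penalty (v t)"] penalty_nonneg \<open>finite T\<close> by fastforce
    then show ?thesis using sum_penalty_nonneg \<open>\<delta> > 0\<close>
      by (simp add: \<mu>_def pos_divide_le_eq mult_left_mono)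
  qed
  then have "\<forall>\<^sub>F A in at_top. \<forall>t\<in>T. \<forall>u\<in>agreeing_off J (v t). objective \<mu> A u \<le> objective \<mu> A (v t) \<longrightarrow>
      v t j - \<delta> \<le> u j \<and> u j \<le> Y t + \<delta>"
    using \<open>finite T\<close> \<open>\<mu> > 0\<close> \<open>\<delta> > 0\<close> v upper
    by (intro eventually_ball_finite ballI minimiser_coordinate_bounds) auto
  then have "\<forall>\<^sub>F A in at_top. 0 \<le> A \<and> (\<forall>t\<in>T. \<forall>u\<in>agreeing_off J (v t).
      objective \<mu> A u \<le> objective \<mu> A (v t) \<longrightarrow> v t j - \<delta> \<le> u j \<and> u j \<le> Y t + \<delta>)"
    using eventually_ge_at_top by (rule eventually_conj [rotated])
  then obtain A where "0 \<le> A" "\<forall>t\<in>T. \<forall>u\<in>agreeing_off J (v t).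
      objective \<mu> A u \<le> objective \<mu> A (v t) \<longrightarrow> v t j - \<delta> \<le> u j \<and> u j \<le> Y t + \<delta>"
    using eventually_happens by force
  with \<open>\<mu> > 0\<close> show ?thesis by (intro that) auto
qed

lemma exists_critical_system:
  assumes E: "polyfun I (2 * l + 1) E"
    and "finite T" "\<delta> > 0" "\<And>t. t \<in> T \<Longrightarrow> E (v t) = 0"
    and "\<And>t u. t \<in> T \<Longrightarrow> u \<in> agreeing_off J (v t) \<Longrightarrow> E u = 0 \<Longrightarrow> u j \<le> Y t"
  obtains g where "\<And>i. polyfun I (2 * l) (g i)"
    "\<And>t. t \<in> T \<Longrightarrow> \<exists>u\<in>agreeing_off J (v t). v t j - \<delta> \<le> u j \<and> u j \<le> Y t + \<delta> \<and>
       (\<forall>i\<in>J. u i ^ (2 * l + 1) = g i u)"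
proof -
  obtain \<mu> A where "\<mu> > 0" "A \<ge> 0"
    and bounds: "\<And>t u. t \<in> T \<Longrightarrow> u \<in> agreeing_off J (v t) \<Longrightarrow>
      objective \<mu> A u \<le> objective \<mu> A (v t) \<Longrightarrow> v t j - \<delta> \<le> u j \<and> u j \<le> Y t + \<delta>"
    using exists_uniform_penalty [of T \<delta> v Y] assms(2-5) by blast
  have "\<forall>i. \<exists>D. polyfun I (2 * l) D \<and>
      (\<forall>u. ((\<lambda>s. E (u(i := s))) has_real_derivative D u) (at (u i)))"
    using polyfun_has_partial_derivative [of I "2 * l" E] E by simp
  then obtain D where D: "\<And>i. polyfun I (2 * l) (D i)"
    "\<And>i u. ((\<lambda>s. E (u(i := s))) has_real_derivative D i u) (at (u i))"
    by metis
  define g where "g i u = 1 / (\<mu> * (2 * l + 2)) * (of_bool (i = j) - A * D i u)" for i u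
  show ?thesis
  proof (rule that)
    show "polyfun I (2 * l) (g i)" for i
      unfolding g_def [abs_def] by (intro polyfun_cmult polyfun_diff polyfun.const D)
    fix t assume "t \<in> T"
    obtain u where u: "u \<in> agreeing_off J (v t)"
      and min: "\<And>w. w \<in> agreeing_off J (v t) \<Longrightarrow> objective \<mu> A u \<le> objective \<mu> A w"
      using objective_attains_min [OF \<open>\<mu> > 0\<close> \<open>A \<ge> 0\<close>] by blast
    have "u i ^ (2 * l + 1) = g i u" if "i \<in> J" for i
      unfolding g_def using min u \<open>\<mu> > 0\<close>
      by (intro critical_equation D that) (simp_all add: agreeing_off_def)
    then show "\<exists>u\<in>agreeing_off J (v t). v t j - \<delta> \<le> u j \<and> u j \<le> Y t + \<delta> \<and>
        (\<forall>i\<in>J. u i ^ (2 * l + 1) = g i u)"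
      using bounds [OF \<open>t \<in> T\<close> u] min [OF agreeing_off_refl] u by blast
  qed
qed

end

section \<open>Second-order conic systems\<close>

abbreviation conic_form ::
    "nat \<Rightarrow> (nat \<Rightarrow> nat \<Rightarrow> nat \<Rightarrow> real) \<Rightarrow> (nat \<Rightarrow> nat \<Rightarrow> real) \<Rightarrow> nat \<Rightarrow> nat \<Rightarrow> (nat \<Rightarrow> real) \<Rightarrow> real" where
  "conic_form n a b j l \<equiv> affine_form n (a j l) (b j l)"

lemma lorentz3_iff_squares:
  "(y\<^sub>1, y\<^sub>2, y\<^sub>3) \<in> lorentz3 \<longleftrightarrow> (\<exists>r s. y\<^sub>3 = r\<^sup>2 \<and> y\<^sub>3\<^sup>2 - y\<^sub>1\<^sup>2 - y\<^sub>2\<^sup>2 = s\<^sup>2)"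
proof
  assume "(y\<^sub>1, y\<^sub>2, y\<^sub>3) \<in> lorentz3"
  then have cone: "sqrt (y\<^sub>1\<^sup>2 + y\<^sub>2\<^sup>2) \<le> y\<^sub>3" by (simp add: lorentz3_def)
  have "0 \<le> y\<^sub>3" by (rule order_trans [OF _ cone]) simp
  moreover have "0 \<le> y\<^sub>3\<^sup>2 - y\<^sub>1\<^sup>2 - y\<^sub>2\<^sup>2" using sqrt_le_D [OF cone] by simp
  ultimately show "\<exists>r s. y\<^sub>3 = r\<^sup>2 \<and> y\<^sub>3\<^sup>2 - y\<^sub>1\<^sup>2 - y\<^sub>2\<^sup>2 = s\<^sup>2"
    by (metis real_sqrt_pow2)
next
  assume "\<exists>r s. y\<^sub>3 = r\<^sup>2 \<and> y\<^sub>3\<^sup>2 - y\<^sub>1\<^sup>2 - y\<^sub>2\<^sup>2 = s\<^sup>2"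
  then have "0 \<le> y\<^sub>3" and "0 \<le> y\<^sub>3\<^sup>2 - y\<^sub>1\<^sup>2 - y\<^sub>2\<^sup>2" by (metis zero_le_power2)+
  then show "(y\<^sub>1, y\<^sub>2, y\<^sub>3) \<in> lorentz3" by (simp add: lorentz3_def real_le_lsqrt)
qed

text \<open>Coordinates \<open>n + j\<close> and \<open>n + m + j\<close> are slack variables, the roots of the two squares.\<close>

definition conic_defect ::
    "nat \<Rightarrow> nat \<Rightarrow> (nat \<Rightarrow> nat \<Rightarrow> nat \<Rightarrow> real) \<Rightarrow> (nat \<Rightarrow> nat \<Rightarrow> real) \<Rightarrow> (nat \<Rightarrow> real) \<Rightarrow> real" where
  "conic_defect n m a b u =
     (\<Sum>j<m. (conic_form n a b j 3 u - (u (n + j))\<^sup>2)\<^sup>2 +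
       ((conic_form n a b j 3 u)\<^sup>2 - (conic_form n a b j 1 u)\<^sup>2 - (conic_form n a b j 2 u)\<^sup>2
          - (u (n + m + j))\<^sup>2)\<^sup>2)"

lemma conic_defect_nonneg: "0 \<le> conic_defect n m a b u"
  unfolding conic_defect_def by (intro sum_nonneg) simp

lemma conic_defect_eq_0_iff:
  "conic_defect n m a b u = 0 \<longleftrightarrow>
     (\<forall>j<m. conic_form n a b j 3 u = (u (n + j))\<^sup>2 \<and>
       (conic_form n a b j 3 u)\<^sup>2 - (conic_form n a b j 1 u)\<^sup>2 - (conic_form n a b j 2 u)\<^sup>2
         = (u (n + m + j))\<^sup>2)"
  unfolding conic_defect_def
  by (subst sum_nonneg_eq_0_iff) (auto simp only: sum_power2_eq_zero_iff right_minus_eq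
      finite_lessThan lessThan_iff sum_power2_ge_zero)

lemma polyfun_conic_defect: "polyfun {..<n + 2 * m} 4 (conic_defect n m a b)"
proof -
  let ?I = "{..<n + 2 * m}"
  have square: "polyfun ?I (2 * d) (\<lambda>u. (f u)\<^sup>2)" if "polyfun ?I d f" for d f
    using that by (rule polyfun_power)
  have form: "polyfun ?I 1 (conic_form n a b j l)" for j l
    unfolding affine_form_def [abs_def]
    by (intro polyfun.add polyfun_sum polyfun_cmult polyfun_proj polyfun.const) auto
  have "polyfun ?I (2 * (2 * 1)) (conic_defect n m a b)"
    unfolding conic_defect_def [abs_def]
    by (intro polyfun_sum polyfun.add square polyfun_diff form polyfun_mono [OF form]
        polyfun_proj) auto
  then show ?thesis by simp
qed

lemma conic_projection_iff_defect_eq_0: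
  assumes "3 \<le> n"
  shows "(x\<^sub>1, x\<^sub>2, x\<^sub>3) \<in> conic_projection n m a b \<longleftrightarrow>
    (\<exists>u. u 0 = x\<^sub>1 \<and> u 1 = x\<^sub>2 \<and> u 2 = x\<^sub>3 \<and> conic_defect n m a b u = 0)"
proof
  assume "(x\<^sub>1, x\<^sub>2, x\<^sub>3) \<in> conic_projection n m a b"
  then obtain w where w: "w 0 = x\<^sub>1" "w 1 = x\<^sub>2" "w 2 = x\<^sub>3"
    and "\<forall>j<m. \<exists>r s. conic_form n a b j 3 w = r\<^sup>2 \<and>
      (conic_form n a b j 3 w)\<^sup>2 - (conic_form n a b j 1 w)\<^sup>2 - (conic_form n a b j 2 w)\<^sup>2 = s\<^sup>2"
    by (auto simp: conic_projection_def lorentz3_iff_squares)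
  then obtain r s where slack: "\<forall>j<m. conic_form n a b j 3 w = (r j)\<^sup>2 \<and>
      (conic_form n a b j 3 w)\<^sup>2 - (conic_form n a b j 1 w)\<^sup>2 - (conic_form n a b j 2 w)\<^sup>2
        = (s j)\<^sup>2"
    by metis
  define u where
    "u i = (if i < n then w i else if i < n + m then r (i - n) else s (i - n - m))" for i
  have "conic_form n a b j l u = conic_form n a b j l w" for j l
    by (simp add: affine_form_def u_def)
  moreover have "u (n + j) = r j" "u (n + m + j) = s j" if "j < m" for j
    using that by (simp_all add: u_def)
  ultimately have "conic_defect n m a b u = 0"
    unfolding conic_defect_eq_0_iff using slack by metis
  then show "\<exists>u. u 0 = x\<^sub>1 \<and> u 1 = x\<^sub>2 \<and> u 2 = x\<^sub>3 \<and> conic_defect n m a b u = 0"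
    using w assms by (intro exI [of _ u]) (simp add: u_def)
next
  assume "\<exists>u. u 0 = x\<^sub>1 \<and> u 1 = x\<^sub>2 \<and> u 2 = x\<^sub>3 \<and> conic_defect n m a b u = 0"
  then show "(x\<^sub>1, x\<^sub>2, x\<^sub>3) \<in> conic_projection n m a b"
    unfolding conic_projection_def conic_defect_eq_0_iff lorentz3_iff_squares by blast
qed

section \<open>The lower bound\<close>

lemma exp_in_Kexp_iff:
  assumes "M > 1" "t \<in> {0..ln M}"
  shows "(exp t, 1, s) \<in> Kexp M \<alpha> \<longleftrightarrow> s \<le> t + \<alpha>"
proof -
  have "1 / M \<le> 1" "1 \<le> exp t" using assms by simp_all
  moreover have "exp t \<le> M" using assms by (simp add: ln_ge_iff)
  ultimately show ?thesis using assms(1) order_trans [of "1 / M" 1 "exp t"] by (auto simp: Kexp_def)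
qed

lemma exists_defect_zero_below_log:
  assumes "3 \<le> n" "M > 1" "t \<in> {0..ln M}" and inner: "Kexp M (-\<epsilon>) \<subseteq> conic_projection n m a b"
  shows "\<exists>u. u 0 = exp t \<and> u 1 = 1 \<and> u 2 = t - \<epsilon> \<and> conic_defect n m a b u = 0"
proof -
  have "(exp t, 1, t - \<epsilon>) \<in> Kexp M (-\<epsilon>)"
    by (simp add: exp_in_Kexp_iff [OF assms(2,3)])
  with inner show ?thesis
    unfolding conic_projection_iff_defect_eq_0 [OF \<open>3 \<le> n\<close>, symmetric] by (rule subsetD)
qed

lemma defect_zero_le_log:
  assumes "3 \<le> n" "M > 1" "t \<in> {0..ln M}" and outer: "conic_projection n m a b \<subseteq> Kexp M \<epsilon>"
    and "u 0 = exp t" "u 1 = 1" "conic_defect n m a b u = 0"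
  shows "u 2 \<le> t + \<epsilon>"
proof -
  have "(exp t, 1, u 2) \<in> conic_projection n m a b"
    unfolding conic_projection_iff_defect_eq_0 [OF \<open>3 \<le> n\<close>] using assms(5-7) by blast
  then have "(exp t, 1, u 2) \<in> Kexp M \<epsilon>" using outer by (rule subsetD [rotated])
  then show ?thesis by (simp add: exp_in_Kexp_iff [OF assms(2,3)])
qed

lemma conic_approx_critical_system:
  assumes "3 \<le> n" "M > 1" "\<epsilon> \<le> 1"
    and inner: "Kexp M (-\<epsilon>) \<subseteq> conic_projection n m a b"
    and outer: "conic_projection n m a b \<subseteq> Kexp M \<epsilon>"
    and "finite T" and T: "T \<subseteq> {0..ln M}"
  shows "\<exists>g. (\<forall>i. polyfun {..<n + 2 * m} 4 (g i)) \<and>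
    (\<forall>t\<in>T. \<exists>u. u 0 = exp t \<and> \<bar>u 2 - t\<bar> \<le> 2 \<and> (\<forall>i\<in>{1..<n + 2 * m}. u i ^ 5 = g i u))"
proof -
  define N where "N = n + 2 * m"
  define E where "E = conic_defect n m a b"
  have E: "polyfun {..<N} 4 E" unfolding E_def N_def by (rule polyfun_conic_defect)
  interpret penalised_maximisation "{2..<N}" 2 2 E
    using \<open>3 \<le> n\<close> polyfun_continuous_on [OF E]
    by unfold_locales (auto simp: N_def E_def conic_defect_nonneg)
  have "\<forall>t\<in>T. \<exists>v. v 0 = exp t \<and> v 1 = 1 \<and> v 2 = t - \<epsilon> \<and> E v = 0"
    unfolding E_def using exists_defect_zero_below_log [OF assms(1,2) subsetD [OF T] inner] by blast
  from bchoice [OF this] obtain v where v: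
    "\<forall>t\<in>T. v t 0 = exp t \<and> v t 1 = 1 \<and> v t 2 = t - \<epsilon> \<and> E (v t) = 0" by blast
  have fixed: "u 0 = exp t" "u 1 = 1" if "t \<in> T" "u \<in> agreeing_off {2..<N} (v t)" for t u
    using that v by (auto simp: agreeing_off_def)
  have upper: "u 2 \<le> t + \<epsilon>" if "t \<in> T" "u \<in> agreeing_off {2..<N} (v t)" "E u = 0" for t u
    using defect_zero_le_log [OF assms(1,2) subsetD [OF T] outer] fixed that
    unfolding E_def by blast
  obtain g where g: "\<And>i. polyfun {..<N} (2 * 2) (g i)"
    and sol: "\<And>t. t \<in> T \<Longrightarrow> \<exists>u\<in>agreeing_off {2..<N} (v t). v t 2 - 1 \<le> u 2 \<and> u 2 \<le> t + \<epsilon> + 1 \<and>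
      (\<forall>i\<in>{2..<N}. u i ^ (2 * 2 + 1) = g i u)"
    by (rule exists_critical_system [of "{..<N}" T 1 v "\<lambda>t. t + \<epsilon>"])
      (use polyfun_mono [OF E] \<open>finite T\<close> v upper in auto)
  \<comment> \<open>The fixed coordinate \<open>1\<close> is not a parameter: it joins the system through \<open>u 1 ^ 5 = 1\<close>.\<close>
  define h where "h = g(1 := \<lambda>_. 1)"
  have "polyfun {..<N} 4 (h i)" for i
    using g [of i] by (auto simp: h_def intro: polyfun.const)
  moreover have "\<exists>u. u 0 = exp t \<and> \<bar>u 2 - t\<bar> \<le> 2 \<and> (\<forall>i\<in>{1..<N}. u i ^ 5 = h i u)" if "t \<in> T" for t
  proof -
    obtain u where u: "u \<in> agreeing_off {2..<N} (v t)" "v t 2 - 1 \<le> u 2" "u 2 \<le> t + \<epsilon> + 1"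
      "\<forall>i\<in>{2..<N}. u i ^ 5 = g i u"
      using sol [OF \<open>t \<in> T\<close>] by auto
    have "u i ^ 5 = h i u" if "i \<in> {1..<N}" for i
      using that u(4) fixed [OF \<open>t \<in> T\<close> u(1)] by (cases "i = 1") (auto simp: h_def)
    moreover have "\<bar>u 2 - t\<bar> \<le> 2"
      using u(2,3) bspec [OF v that] \<open>\<epsilon> \<le> 1\<close> by linarith
    ultimately show ?thesis using fixed [OF that u(1)] by blast
  qed
  ultimately show ?thesis unfolding N_def by blast
qed

lemma card_separated_le_of_conic_approx:
  fixes n m :: nat
  defines "S \<equiv> 2 * 5 ^ (n + 2 * m - 1)"
  assumes "3 \<le> n" "M > 1" "\<epsilon> \<le> 1"
    and "Kexp M (-\<epsilon>) \<subseteq> conic_projection n m a b" "conic_projection n m a b \<subseteq> Kexp M \<epsilon>"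
    and "finite T" "T \<subseteq> {0..ln M}" and sep: "pairwise (\<lambda>s t. 8 * real S + 20 \<le> \<bar>s - t\<bar>) T"
  shows "card T \<le> (S + 1) * (2 * S + 1)"
proof (cases "T = {}")
  case False
  then obtain t\<^sub>0 where "t\<^sub>0 \<in> T" by blast
  define J where "J = {1..<n + 2 * m}"
  have insert_J: "insert 0 J = {..<n + 2 * m}" using \<open>3 \<le> n\<close> by (auto simp: J_def)
  obtain g where g: "\<And>i. polyfun {..<n + 2 * m} 4 (g i)"
    and "\<forall>t\<in>T. \<exists>u. u 0 = exp t \<and> \<bar>u 2 - t\<bar> \<le> 2 \<and> (\<forall>i\<in>J. u i ^ 5 = g i u)"
    using conic_approx_critical_system [OF assms(2-8)] unfolding J_def by blast
  from bchoice [OF this(2)] obtain u where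
    u: "\<forall>t\<in>T. u t 0 = exp t \<and> \<bar>u t 2 - t\<bar> \<le> 2 \<and> (\<forall>i\<in>J. u t i ^ 5 = g i (u t))"
    by blast
  define w where "w t = u (if t \<in> T then t else t\<^sub>0)" for t
  have "w t i ^ Suc 4 = g i (w t)" if "i \<in> J" for t i
    using u that \<open>t\<^sub>0 \<in> T\<close> by (simp add: w_def)
  then obtain p :: "real poly poly" where p: "p \<noteq> 0" "degree p \<le> S" "\<And>i. degree (coeff p i) \<le> S"
      "\<And>t. poly (poly p [:w t 0:]) (w t 2) = 0"
    using exists_bivariate_relation [of J 0 2 4 g w] g [folded insert_J] \<open>3 \<le> n\<close>
    by (auto simp: J_def S_def)
  show ?thesis
  proof (rule card_zeros_near_log_le [OF p(1-3) \<open>finite T\<close> sep])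
    fix t assume "t \<in> T"
    then have "w t = u t" by (simp add: w_def)
    then show "\<bar>w t 2 - t\<bar> \<le> 2" "poly (poly p [:exp t:]) (w t 2) = 0"
      using bspec [OF u \<open>t \<in> T\<close>] p(4) [of t] by simp_all
  qed
qed simp

lemma ln_less_of_conic_approx:
  fixes n m :: nat
  defines "S \<equiv> 2 * 5 ^ (n + 2 * m - 1)"
  assumes "3 \<le> n" "M > 1" "\<epsilon> \<le> 1"
    and "Kexp M (-\<epsilon>) \<subseteq> conic_projection n m a b" "conic_projection n m a b \<subseteq> Kexp M \<epsilon>"
  shows "ln M < real ((8 * S + 20) * ((S + 1) * (2 * S + 1)))"
proof (rule ccontr)
  define B where "B = 8 * real S + 20"
  define K where "K = (S + 1) * (2 * S + 1)"
  define T where "T = (\<lambda>k. B * real k) ` {..K}"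
  have "B > 0" by (simp add: B_def)
  assume "\<not> ?thesis"
  moreover have "B * K = real ((8 * S + 20) * ((S + 1) * (2 * S + 1)))"
    by (simp add: B_def K_def algebra_simps)
  ultimately have "B * K \<le> ln M" by linarith
  have "B * real k \<in> {0..ln M}" if "k \<le> K" for k
  proof -
    have "B * real k \<le> ln M"
      by (rule order_trans [OF _ \<open>B * K \<le> ln M\<close>]) (use that \<open>B > 0\<close> in simp)
    then show ?thesis using \<open>B > 0\<close> by simp
  qed
  then have "T \<subseteq> {0..ln M}" by (auto simp: T_def)
  moreover have "B \<le> \<bar>B * real k - B * real k'\<bar>" if "B * real k \<noteq> B * real k'" for k k'
  proof -
    have "B * 1 \<le> B * \<bar>real k - real k'\<bar>"
      using that \<open>B > 0\<close> by (intro mult_left_mono) auto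
    then show ?thesis using \<open>B > 0\<close> by (simp add: abs_mult right_diff_distrib [symmetric])
  qed
  then have "pairwise (\<lambda>s t. B \<le> \<bar>s - t\<bar>) T" by (auto simp: pairwise_def T_def)
  moreover have "finite T" by (simp add: T_def)
  ultimately have "card T \<le> K"
    unfolding K_def S_def B_def by (intro card_separated_le_of_conic_approx [OF assms(2-6)])
  moreover have "card T = K + 1"
    using \<open>B > 0\<close> by (simp add: T_def card_image inj_on_def)
  ultimately show False by simp
qed

lemma second_order_conic_approx_ge_3: "second_order_conic_approx q C \<Longrightarrow> 3 \<le> q"
  by (auto simp: second_order_conic_approx_def)

lemma ln_ln_le_of_conic_approx:
  assumes C: "second_order_conic_approx q C" and "M > 1" "\<epsilon> \<le> 1" "Kexp M (-\<epsilon>) \<subseteq> C" "C \<subseteq> Kexp M \<epsilon>"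
  shows "ln (ln M) \<le> 4 * ln 25 * real q"
proof -
  obtain n m a b where nm: "3 \<le> n" "n + m = q" and C_eq: "C = conic_projection n m a b"
    using C by (auto simp: second_order_conic_approx_def)
  define S :: nat where "S = 2 * 5 ^ (n + 2 * m - 1)"
  define Q :: nat where "Q = 25 ^ q"
  have "(5::nat) ^ (n + 2 * m - 1) \<le> 5 ^ (2 * q)"
    using nm by (intro power_increasing) auto
  also have "\<dots> = Q" by (simp add: Q_def power_mult)
  finally have "S \<le> 2 * Q" by (simp add: S_def)
  moreover have "1 \<le> Q" by (simp add: Q_def)
  ultimately have "(8 * S + 20) * ((S + 1) * (2 * S + 1)) \<le> (36 * Q) * ((3 * Q) * (5 * Q))"
    by (intro mult_mono) auto
  also have "\<dots> \<le> 25 ^ 3 * Q ^ 3"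
    by (simp add: power3_eq_cube)
  also have "\<dots> = 25 ^ (3 + 3 * q)"
    by (simp add: Q_def power_add power_mult [symmetric] mult.commute)
  also have "\<dots> \<le> 25 ^ (4 * q)"
    using second_order_conic_approx_ge_3 [OF C] by (intro power_increasing) auto
  finally have "real ((8 * S + 20) * ((S + 1) * (2 * S + 1))) \<le> real (25 ^ (4 * q))"
    by (simp only: of_nat_le_iff)
  moreover have "ln M < real ((8 * S + 20) * ((S + 1) * (2 * S + 1)))"
    unfolding S_def by (rule ln_less_of_conic_approx [OF nm(1) assms(2-5) [unfolded C_eq]])
  ultimately have "ln M \<le> 25 ^ (4 * q)" by simp
  then have "ln (ln M) \<le> ln (25 ^ (4 * q))"
    using \<open>M > 1\<close> by (intro ln_mono) auto
  also have "\<dots> = 4 * ln 25 * real q" by (simp add: ln_realpow)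
  finally show ?thesis .
qed

theorem corollary5:
  fixes \<epsilon>\<^sub>0 :: real
  assumes "0 < \<epsilon>\<^sub>0" and "\<epsilon>\<^sub>0 < 1"
  shows "\<exists>c>0. \<forall>M>1. \<forall>\<epsilon>\<in>{0<..1}. \<epsilon> \<notin> {\<epsilon>\<^sub>0<..<1} \<longrightarrow>
           (\<forall>q C. second_order_conic_approx q C \<longrightarrow>
                   Kexp M (-\<epsilon>) \<subseteq> C \<longrightarrow> C \<subseteq> Kexp M \<epsilon> \<longrightarrow>
                   real q \<ge> c * (1 + ln (ln M) / ln (1 / \<epsilon>)))"
proof -
  define \<kappa> where "\<kappa> = 4 * ln 25 / ln (1 / \<epsilon>\<^sub>0)"
  have "0 < ln (1 / \<epsilon>\<^sub>0)" using assms by simp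
  then have "\<kappa> > 0" by (simp add: \<kappa>_def)
  have "1 / (1 + \<kappa>) * (1 + ln (ln M) / ln (1 / \<epsilon>)) \<le> real q"
    if "M > 1" and \<epsilon>: "\<epsilon> \<in> {0<..1}" "\<epsilon> \<notin> {\<epsilon>\<^sub>0<..<1}"
      and C: "second_order_conic_approx q C" "Kexp M (-\<epsilon>) \<subseteq> C" "C \<subseteq> Kexp M \<epsilon>" for M \<epsilon> q C
  proof -
    \<comment> \<open>For \<open>\<epsilon> = 1\<close> the quotient is a division by \<open>0\<close>, hence \<open>0\<close>.\<close>
    have "ln (ln M) / ln (1 / \<epsilon>) \<le> \<kappa> * q"
    proof (cases "\<epsilon> = 1")
      case False
      then have "ln (1 / \<epsilon>\<^sub>0) \<le> ln (1 / \<epsilon>)" using \<epsilon> by (intro ln_mono) (auto simp: frac_le)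
      then have "ln (ln M) / ln (1 / \<epsilon>) \<le> 4 * ln 25 * q / ln (1 / \<epsilon>\<^sub>0)"
        using ln_ln_le_of_conic_approx [OF C(1) \<open>M > 1\<close> _ C(2,3)] \<epsilon>(1) \<open>0 < ln (1 / \<epsilon>\<^sub>0)\<close>
        by (intro frac_le) auto
      then show ?thesis by (simp add: \<kappa>_def)
    qed (use \<open>\<kappa> > 0\<close> in simp)
    then have "1 + ln (ln M) / ln (1 / \<epsilon>) \<le> (1 + \<kappa>) * q"
      using second_order_conic_approx_ge_3 [OF C(1)] by (simp add: algebra_simps)
    then show ?thesis using \<open>\<kappa> > 0\<close> by (simp add: field_simps)
  qed
  then show ?thesis using \<open>\<kappa> > 0\<close> by (intro exI [of _ "1 / (1 + \<kappa>)"]) auto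
qed

end
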